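(* Consider the Random Actions (RA) model with $N$ agents, parameter $\alpha\in(0,1)$ and an irreducible row-stochastic trust matrix $W$. For every $\epsilon>0$ and every $\delta>0$ there exists a time instant $t_{\epsilon,\delta}\in\mathbb{N}$ such that for every $S\in\mathbb{N}$, $$\mathbb{P}\left(\bigcap_{s=0}^{S} C^{\mathbf 0}_{t_{\epsilon,\delta}+s}(\delta)\right)+\mathbb{P}\left(\bigcap_{s=0}^{S} C^{\mathbf 1}_{t_{\epsilon,\delta}+s}(\delta)\right)>1-\epsilon .$$
   Context: $\mathbb{N}=\{1,2,\dots\}$. Random Actions (RA) model: there are $N$ agents, a constant $\alpha\in(0,1)$, and an $N\times N$ row-stochastic matrix $W=(w_{ij})$ (nonnegative entries, each row sums to $1$); $w_{ij}>0$ is regarded as a directed edge from $j$ to $i$. The network is assumed strongly connected, i.e. $W$ is irreducible. The initial opinion vector $\mathbf{x}_1$ is a random vector in $[0,1]^N$ with arbitrary distribution. For each $t\in\mathbb{N}$, conditionally on the history $(\mathbf{x}_1,\mathbf{a}_1,\dots,\mathbf{a}_{t-1})$ (which determines $\mathbf{x}_t$), the actions $a_{t,1},\dots,a_{t,N}\in\{0,1\}$ are independent with $a_{t,i}\sim\mathrm{Bernoulli}(x_{t,i})$ (i.e. $a_{t,i}=1$ with probability $x_{t,i}$), and opinions are updated by $$\mathbf{x}_{t+1}=(1-\alpha)\mathbf{x}_t+\alpha W\mathbf{a}_t .$$ Thus $\mathbf{x}_t\in[0,1]^N$ for all $t$. For $t\in\mathbb{N}$ and $\delta>0$ define the events $$C^{\mathbf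 0}_t(\delta)=\{0\le x_{t,i}<\delta \text{ for all } i=1,\dots,N\},\qquad C^{\mathbf 1}_t(\delta)=\{1-\delta<x_{t,i}\le 1\text{ for all } i=1,\dots,N\}.$$ *)

theory Defs
  imports "HOL-Probability.Probability"
begin

definition row_stochastic :: "real ^ 'n ^ 'n \<Rightarrow> bool" where
  "row_stochastic W \<longleftrightarrow> (\<forall>i j. 0 \<le> W $ i $ j) \<and> (\<forall>i. (\<Sum>j\<in>UNIV. W $ i $ j) = 1)"

text \<open>A positive entry \<open>W $ i $ j\<close> is an edge from \<open>j\<close> to \<open>i\<close>;
  irreducibility is strong connectedness of this digraph.\<close>

definition network :: "real ^ 'n ^ 'n \<Rightarrow> ('n \<times> 'n) set" where
  "network W = {(j, i). W $ i $ j > 0}"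

definition irreducible_matrix :: "real ^ 'n ^ 'n \<Rightarrow> bool" where
  "irreducible_matrix W \<longleftrightarrow> (\<forall>i j. (i, j) \<in> (network W)\<^sup>*)"

text \<open>Conditional probability of an event given a sub-sigma-algebra \<open>F\<close>. It is a function
  determined only almost everywhere; the library's \<^const>\<open>cond_prob\<close> conditions on events.\<close>

definition prob_given :: "'o measure \<Rightarrow> 'o measure \<Rightarrow> ('o \<Rightarrow> bool) \<Rightarrow> 'o \<Rightarrow> real" where
  "prob_given M F P = real_cond_exp M F (indicator {\<omega> \<in> space M. P \<omega>})"

definition cond_indep_vars ::
  "'o measure \<Rightarrow> 'o measure \<Rightarrow> ('i \<Rightarrow> 'b measure) \<Rightarrow> ('i \<Rightarrow> 'o \<Rightarrow> 'b) \<Rightarrow> 'i set \<Rightarrow> bool" where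
  "cond_indep_vars M F M' X I \<longleftrightarrow>
     (\<forall>i\<in>I. X i \<in> measurable M (M' i)) \<and>
     (\<forall>J. J \<subseteq> I \<longrightarrow> J \<noteq> {} \<longrightarrow> finite J \<longrightarrow>
        (\<forall>A \<in> (\<Pi> j\<in>J. sets (M' j)).
           AE \<omega> in M. prob_given M F (\<lambda>\<omega>. \<forall>j\<in>J. X j \<omega> \<in> A j) \<omega> =
                      (\<Prod>j\<in>J. prob_given M F (\<lambda>\<omega>. X j \<omega> \<in> A j) \<omega>)))"

text \<open>The sigma-algebra generated by \<open>(x 1, a 1, \<dots>, a (t - 1))\<close>.\<close>

definition history ::
  "'o measure \<Rightarrow> (nat \<Rightarrow> 'o \<Rightarrow> real ^ 'n) \<Rightarrow> (nat \<Rightarrow> 'o \<Rightarrow> real ^ 'n) \<Rightarrow> nat \<Rightarrow> 'o measure" where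
  "history M x a t =
     vimage_algebra (space M) (\<lambda>\<omega>. (x 1 \<omega>, \<lambda>s\<in>{1..<t}. a s \<omega>))
       (borel \<Otimes>\<^sub>M (\<Pi>\<^sub>M s\<in>{1..<t}. borel))"

text \<open>Time starts at 1; \<open>x 0\<close> and \<open>a 0\<close> are unconstrained and play no role.\<close>

locale random_actions = prob_space M
  for M :: "'o measure" +
  fixes \<alpha> :: real
    and W :: "real ^ 'n ^ 'n"
    and x a :: "nat \<Rightarrow> 'o \<Rightarrow> real ^ 'n"
  assumes alpha: "0 < \<alpha>" "\<alpha> < 1"
    and stochastic: "row_stochastic W"
    and irreducible: "irreducible_matrix W"
    and initial_measurable: "x 1 \<in> borel_measurable M"
    and initial_range: "\<And>\<omega> i. \<omega> \<in> space M \<Longrightarrow> x 1 \<omega> $ i \<in> {0..1}"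
    and action_measurable: "\<And>t. t \<ge> 1 \<Longrightarrow> a t \<in> borel_measurable M"
    and action_range: "\<And>t \<omega> i. t \<ge> 1 \<Longrightarrow> \<omega> \<in> space M \<Longrightarrow> a t \<omega> $ i \<in> {0, 1}"
    and action_indep: "\<And>t. t \<ge> 1 \<Longrightarrow>
      cond_indep_vars M (history M x a t) (\<lambda>_. borel) (\<lambda>i \<omega>. a t \<omega> $ i) UNIV"
    and action_bernoulli: "\<And>t i. t \<ge> 1 \<Longrightarrow>
      AE \<omega> in M. prob_given M (history M x a t) (\<lambda>\<omega>. a t \<omega> $ i = 1) \<omega> = x t \<omega> $ i"
    and update: "\<And>t \<omega>. t \<ge> 1 \<Longrightarrow> \<omega> \<in> space M \<Longrightarrow>
      x (Suc t) \<omega> = (1 - \<alpha>) *\<^sub>R x t \<omega> + \<alpha> *\<^sub>R (W *v a t \<omega>)"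
begin

lemma subalgebra_history: "subalgebra M (history M x a t)"
proof -
  have "(\<lambda>\<omega>. (x 1 \<omega>, \<lambda>s\<in>{1..<t}. a s \<omega>)) \<in> measurable M (borel \<Otimes>\<^sub>M (\<Pi>\<^sub>M s\<in>{1..<t}. borel))"
    using initial_measurable action_measurable
    by (intro measurable_Pair measurable_restrict) auto
  then show ?thesis
    unfolding subalgebra_def history_def
    by (intro conjI sets_image_in_sets) auto
qed

end

definition consensus0 ::
  "'o measure \<Rightarrow> (nat \<Rightarrow> 'o \<Rightarrow> real ^ 'n) \<Rightarrow> real \<Rightarrow> nat \<Rightarrow> 'o set" where
  "consensus0 M x \<delta> t = {\<omega> \<in> space M. \<forall>i. 0 \<le> x t \<omega> $ i \<and> x t \<omega> $ i < \<delta>}"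

definition consensus1 ::
  "'o measure \<Rightarrow> (nat \<Rightarrow> 'o \<Rightarrow> real ^ 'n) \<Rightarrow> real \<Rightarrow> nat \<Rightarrow> 'o set" where
  "consensus1 M x \<delta> t = {\<omega> \<in> space M. \<forall>i. 1 - \<delta> < x t \<omega> $ i \<and> x t \<omega> $ i \<le> 1}"

end

theory Submission
  imports Defs
begin

text \<open>Let \<open>p\<close> be the stationary distribution of \<open>W\<close>, which is positive by irreducibility. The
  weighted mean \<open>\<Sum>i. p $ i * x t $ i\<close> is a bounded martingale, so the variances of its increments
  are summable; as the actions are conditionally uncorrelated, these variances are
  \<open>\<alpha>\<^sup>2 * (\<Sum>i. (p $ i)\<^sup>2 * E (a t $ i - x t $ i)\<^sup>2)\<close>. Hence \<open>a t $ i - x t $ i\<close> tends to 0 almost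
  surely for every agent. The rest is deterministic: opinions come close to \<open>{0, 1}\<close>, and since
  \<open>x (t + 1) $ i\<close> is a proper average involving \<open>x t $ i\<close> and \<open>a t $ j\<close> for every edge from \<open>j\<close> to
  \<open>i\<close>, it can only be close to \<open>{0, 1}\<close> if these two agree. So neighbours, and by connectedness all
  agents, eventually act alike and never change their action. Continuity of the measure concludes.\<close>

section \<open>The stationary distribution of the trust matrix\<close>

text \<open>Brouwer's fixed point theorem on the probability simplex, which \<open>p v* W\<close>
  preserves because \<open>W\<close> is nonnegative with row sums 1.\<close>

lemma stationary_distribution:
  fixes W :: "real ^ 'n ^ 'n"
  assumes W: "row_stochastic W"
  obtains p :: "real ^ 'n"
  where "\<And>i. 0 \<le> p $ i" and "(\<Sum>i\<in>UNIV. p $ i) = 1" and "p v* W = p"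
proof -
  define S where "S = {p :: real ^ 'n. (\<forall>i. 0 \<le> p $ i) \<and> (\<Sum>i\<in>UNIV. p $ i) = 1}"
  have W0: "0 \<le> W $ i $ j" and W1: "(\<Sum>j\<in>UNIV. W $ i $ j) = 1" for i j
    using W by (auto simp: row_stochastic_def)
  have "closed S"
    unfolding S_def by (intro closed_Collect_conj closed_Collect_all closed_Collect_le
        closed_Collect_eq continuous_intros)
  moreover have "bounded S"
    unfolding bounded_iff
  proof (intro exI ballI)
    fix p assume "p \<in> S"
    then show "norm p \<le> 1"
      using norm_le_l1_cart[of p] by (simp add: S_def)
  qed
  ultimately have "compact S"
    by (simp add: compact_eq_bounded_closed)
  moreover have "convex S"
    unfolding convex_def S_def
    by (auto simp: sum.distrib simp flip: sum_distrib_left)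
  \<comment> \<open>Any vertex of the simplex shows that it is nonempty; \<open>undefined\<close>
    serves as an arbitrary index.\<close>
  moreover have "axis undefined 1 \<in> S"
    by (simp add: S_def axis_def)
  then have "S \<noteq> {}"
    by blast
  moreover have "continuous_on S (\<lambda>p. p v* W)"
    unfolding vector_matrix_mult_def by (intro continuous_intros)
  moreover have "(\<lambda>p. p v* W) \<in> S \<rightarrow> S"
  proof
    fix p assume p: "p \<in> S"
    have "(\<Sum>j\<in>UNIV. \<Sum>i\<in>UNIV. p $ i * W $ i $ j) = (\<Sum>i\<in>UNIV. p $ i * (\<Sum>j\<in>UNIV. W $ i $ j))"
      by (subst sum.swap) (simp add: sum_distrib_left)
    with p show "p v* W \<in> S"
      by (auto simp: S_def vector_matrix_mult_def W1 intro!: sum_nonneg mult_nonneg_nonneg W0)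
  qed
  ultimately obtain p where "p \<in> S" "p v* W = p"
    by (rule brouwer)
  then show thesis
    by (intro that) (auto simp: S_def)
qed

text \<open>Some agent \<open>k\<close> has positive weight, and stationarity passes positivity from
  the head of an edge to its tail. Following a path from \<open>j\<close> to \<open>k\<close>
  backwards therefore reaches \<open>j\<close>.\<close>

lemma irreducible_stationary_positive:
  fixes W :: "real ^ 'n ^ 'n"
  assumes W: "row_stochastic W" "irreducible_matrix W"
    and p: "\<And>i. 0 \<le> p $ i" "(\<Sum>i\<in>UNIV. p $ i) = 1" "p v* W = p"
  shows "0 < p $ j"
proof -
  obtain k where "p $ k \<noteq> 0"
    using p(2) by (metis sum.neutral zero_neq_one)
  then have k: "0 < p $ k"
    using p(1)[of k] by simp
  have step: "0 < p $ i" if "W $ l $ i > 0" "0 < p $ l" for i l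
  proof -
    have "0 < p $ l * W $ l $ i"
      using that by simp
    also have "\<dots> \<le> (\<Sum>l\<in>UNIV. p $ l * W $ l $ i)"
      using W(1) p(1) by (intro member_le_sum) (auto simp: row_stochastic_def)
    also have "\<dots> = (p v* W) $ i"
      by (simp add: vector_matrix_mult_def)
    finally show ?thesis
      by (simp add: p(3))
  qed
  have "(j, k) \<in> (network W)\<^sup>*"
    using W(2) by (simp add: irreducible_matrix_def)
  then show ?thesis
    by (induction rule: converse_rtrancl_induct) (auto simp: k network_def intro: step)
qed

section \<open>Deterministic analysis of a single trajectory\<close>

text \<open>The variance of a mixture with mean \<open>y\<close> of Bernoulli laws is \<open>y * (1 - y)\<close> and dominates the
  variance of the means that are mixed.\<close>

lemma variance_bound:
  fixes \<alpha> :: real and w b :: "'i \<Rightarrow> real"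
  assumes "finite I" "j \<in> I" "0 < \<alpha>" "\<alpha> < 1" "0 \<le> x" "x \<le> 1"
    and w: "\<And>i. i \<in> I \<Longrightarrow> 0 \<le> w i" "sum w I = 1"
    and b: "\<And>i. i \<in> I \<Longrightarrow> b i \<in> {0, 1}"
    and y: "y = (1 - \<alpha>) * x + \<alpha> * (\<Sum>i\<in>I. w i * b i)"
  shows "\<alpha> * (1 - \<alpha>) * w j * (x - b j)\<^sup>2 \<le> y * (1 - y)"
proof -
  define s where "s = (\<Sum>i\<in>I. w i * b i)"
  have bb: "(\<Sum>i\<in>I. w i * (b i)\<^sup>2) = s"
    unfolding s_def using b by (intro sum.cong) (fastforce simp: power2_eq_square)+
  have "w j * (x - b j)\<^sup>2 \<le> (\<Sum>i\<in>I. w i * (x - b i)\<^sup>2)"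
    using assms(1,2) w(1) by (intro member_le_sum) auto
  also have "\<dots> = (\<Sum>i\<in>I. w i * x\<^sup>2 - 2 * x * (w i * b i) + w i * (b i)\<^sup>2)"
    by (intro sum.cong) (auto simp: power2_eq_square algebra_simps)
  also have "\<dots> = x\<^sup>2 - 2 * x * s + s"
    by (simp add: sum.distrib sum_subtractf bb w(2) s_def
        flip: sum_distrib_left sum_distrib_right)
  finally have 1: "w j * (x - b j)\<^sup>2 \<le> x\<^sup>2 - 2 * x * s + s" .
  have s: "0 \<le> s"
    unfolding s_def using w(1) b by (intro sum_nonneg) fastforce
  have "s \<le> (\<Sum>i\<in>I. w i)"
    unfolding s_def using w(1) b by (intro sum_mono) fastforce
  with w(2) have s1: "s \<le> 1" by simp
  \<comment> \<open>Law of total variance: the first summand is the variance inside the component of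
    mean \<open>x\<close>, the other two together are the variance of the means. The last one is
    \<open>\<alpha> * (1 - \<alpha>)\<close> times the mean square distance of \<open>x\<close> from
    the \<open>b i\<close>.\<close>
  have "y * (1 - y) = (1 - \<alpha>) * (x * (1 - x)) + \<alpha>\<^sup>2 * (s * (1 - s))
      + \<alpha> * (1 - \<alpha>) * (x\<^sup>2 - 2 * x * s + s) "
    unfolding y s_def[symmetric] by (simp add: power2_eq_square algebra_simps)
  moreover have "0 \<le> (1 - \<alpha>) * (x * (1 - x))" "0 \<le> \<alpha>\<^sup>2 * (s * (1 - s))"
    using assms(3-6) s s1 by simp_all
  moreover have "\<alpha> * (1 - \<alpha>) * (w j * (x - b j)\<^sup>2) \<le> \<alpha> * (1 - \<alpha>) * (x\<^sup>2 - 2 * x * s + s)"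
    using assms(3,4) 1 by (intro mult_left_mono) auto
  ultimately show ?thesis
    by (simp add: mult.assoc)
qed

text \<open>Increments of a 0/1 sequence lie in {-1, 0, 1}, so once they are smaller than 1 in
  absolute value they vanish and the sequence is constant.\<close>

lemma binary_sequence_convergent:
  fixes b :: "nat \<Rightarrow> real"
  assumes b: "\<And>n. b n \<in> {0, 1}" and lim: "(\<lambda>n. b (Suc n) - b n) \<longlonglongrightarrow> 0"
  shows "b \<longlonglongrightarrow> 0 \<or> b \<longlonglongrightarrow> 1"
proof -
  have "\<forall>\<^sub>F n in sequentially. norm (b (Suc n) - b n) < 1"
    using lim by (auto dest: tendstoD[where e = 1])
  then obtain K where K: "\<And>n. n \<ge> K \<Longrightarrow> norm (b (Suc n) - b n) < 1"
    by (auto simp: eventually_sequentially)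
  have step: "b (Suc n) = b n" if "n \<ge> K" for n
    using K[OF that] b[of n] b[of "Suc n"] by auto
  have const: "b n = b K" if "n \<ge> K" for n
    using that by (induction rule: dec_induct) (auto simp: step)
  then have "b \<longlonglongrightarrow> b K"
    by (intro tendsto_eventually eventually_sequentiallyI[of K] const)
  then show ?thesis
    using b[of K] by auto
qed

text \<open>To be applied to almost every trajectory, shifted so that indices start at 0. The
  assumption \<open>lim\<close> is all that probability has to supply.\<close>

lemma deterministic_consensus:
  fixes W :: "real ^ 'n ^ 'n" and x a :: "nat \<Rightarrow> real ^ 'n"
  assumes alpha: "0 < \<alpha>" "\<alpha> < 1"
    and W: "row_stochastic W" "irreducible_matrix W"
    and x: "\<And>n i. x n $ i \<in> {0..1}" and a: "\<And>n i. a n $ i \<in> {0, 1}"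
    and update: "\<And>n. x (Suc n) = (1 - \<alpha>) *\<^sub>R x n + \<alpha> *\<^sub>R (W *v a n)"
    and lim: "\<And>i. (\<lambda>n. a n $ i - x n $ i) \<longlonglongrightarrow> 0"
  shows "(\<forall>i. (\<lambda>n. x n $ i) \<longlonglongrightarrow> 0) \<or> (\<forall>i. (\<lambda>n. x n $ i) \<longlonglongrightarrow> 1)"
proof -
  have W0: "0 \<le> W $ i $ j" and W1: "(\<Sum>j\<in>UNIV. W $ i $ j) = 1" for i j
    using W by (auto simp: row_stochastic_def)
  have upd: "x (Suc n) $ i = (1 - \<alpha>) * x n $ i + \<alpha> * (\<Sum>j\<in>UNIV. W $ i $ j * a n $ j)" for n i
    by (simp add: update matrix_vector_mult_def)
  \<comment> \<open>As \<open>a n $ i\<close> is 0 or 1, its distance from \<open>x n $ i\<close> is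
    \<open>x n $ i\<close> or \<open>1 - x n $ i\<close>, and the product is below both.\<close>
  have prod: "(\<lambda>n. x n $ i * (1 - x n $ i)) \<longlonglongrightarrow> 0" for i
  proof (rule Lim_null_comparison[OF _ tendsto_norm_zero[OF lim[of i]]])
    show "\<forall>\<^sub>F n in sequentially. norm (x n $ i * (1 - x n $ i)) \<le> norm (a n $ i - x n $ i)"
    proof (intro always_eventually allI)
      fix n
      have "x n $ i * (1 - x n $ i) \<le> 1 - x n $ i" "x n $ i * (1 - x n $ i) \<le> x n $ i"
        using x[of n i] by (auto intro: mult_left_le_one_le mult_right_le_one_le)
      then show "norm (x n $ i * (1 - x n $ i)) \<le> norm (a n $ i - x n $ i)"
        using x[of n i] a[of n i] by (auto simp: abs_mult)
    qed
  qed
  \<comment> \<open>\<open>variance_bound\<close> with \<open>x (Suc n) $ i\<close> as the mixture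
    mean: the squared difference is controlled by the product just shown to vanish, one step later.
    The factor \<open>c\<close> is positive because there is an edge.\<close>
  have edge: "(\<lambda>n. x n $ i - a n $ j) \<longlonglongrightarrow> 0" if "W $ i $ j > 0" for i j
  proof -
    define c where "c = \<alpha> * (1 - \<alpha>) * W $ i $ j"
    have c: "0 < c"
      using alpha that by (simp add: c_def)
    have "(x n $ i - a n $ j)\<^sup>2 \<le> (x (Suc n) $ i * (1 - x (Suc n) $ i)) / c" for n
      using variance_bound[of UNIV j \<alpha> "x n $ i" "\<lambda>j. W $ i $ j" "\<lambda>j. a n $ j",
          OF _ _ _ _ _ _ _ _ _ upd[of n i]]
        alpha x[of n i] W0 W1 a c by (simp add: c_def field_simps)
    moreover have "(\<lambda>n. (x (Suc n) $ i * (1 - x (Suc n) $ i)) / c) \<longlonglongrightarrow> 0"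
      using LIMSEQ_Suc[OF prod[of i]] by (intro tendsto_divide_zero)
    ultimately have "(\<lambda>n. (x n $ i - a n $ j)\<^sup>2) \<longlonglongrightarrow> 0"
      by (rule tendsto_sandwich[OF always_eventually[OF allI] always_eventually[OF allI]
            tendsto_const, rotated]) simp
    then show ?thesis
      by (simp add: power_tendsto_0_iff)
  qed
  \<comment> \<open>Induction along a path: for an edge from \<open>k\<close> to \<open>l\<close>,
    both actions approach \<open>x n $ l\<close>, the action of \<open>k\<close> by
    \<open>edge\<close> and that of \<open>l\<close> by \<open>lim\<close>.\<close>
  have aa: "(\<lambda>n. a n $ i - a n $ j) \<longlonglongrightarrow> 0" for i j
  proof -
    have "(i, j) \<in> (network W)\<^sup>*"
      using W by (simp add: irreducible_matrix_def)
    then show ?thesis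
    proof (induction rule: rtrancl_induct)
      case (step k l)
      then have "(\<lambda>n. x n $ l - a n $ k) \<longlonglongrightarrow> 0"
        by (intro edge) (simp add: network_def)
      from tendsto_diff[OF tendsto_diff[OF step.IH lim[of l]] this] show ?case
        by simp
    qed simp
  qed
  have ax: "(\<lambda>n. a n $ i - x n $ j) \<longlonglongrightarrow> 0" for i j
    using tendsto_add[OF aa[of i j] lim[of j]] by simp
  have inc: "(\<lambda>n. x (Suc n) $ i - x n $ i) \<longlonglongrightarrow> 0" for i
  proof -
    \<comment> \<open>Row sums 1 allow \<open>x n $ i\<close> to be moved inside the weighted
      average.\<close>
    have "x (Suc n) $ i - x n $ i = \<alpha> * (\<Sum>j\<in>UNIV. W $ i $ j * (a n $ j - x n $ i))" for n
      by (simp add: upd right_diff_distrib sum_subtractf W1 algebra_simps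
          flip: sum_distrib_left sum_distrib_right)
    then show ?thesis
      by (simp, intro tendsto_mult_right_zero tendsto_null_sum ax)
  qed
  \<comment> \<open>One arbitrary agent decides the limit for all, by \<open>ax\<close>. Its action
    increment is the opinion increment plus the change of the difference between action and
    opinion.\<close>
  have "(\<lambda>n. a n $ undefined) \<longlonglongrightarrow> 0 \<or> (\<lambda>n. a n $ undefined) \<longlonglongrightarrow> 1"
  proof (rule binary_sequence_convergent)
    show "(\<lambda>n. a (Suc n) $ undefined - a n $ undefined) \<longlonglongrightarrow> 0"
      using tendsto_diff[OF tendsto_add[OF LIMSEQ_Suc[OF lim[of undefined]] inc[of undefined]]
          lim[of undefined]] by simp
  qed (rule a)
  moreover have "(\<lambda>n. x n $ j) \<longlonglongrightarrow> c" if "(\<lambda>n. a n $ undefined) \<longlonglongrightarrow> c" for c j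
    using tendsto_diff[OF that ax[of undefined j]] by simp
  ultimately show ?thesis
    by blast
qed

section \<open>Range of the opinions and measurability with respect to the history\<close>

context random_actions
begin

lemma opinion_Suc:
  assumes "t \<ge> 1" "\<omega> \<in> space M"
  shows "x (Suc t) \<omega> $ i = (1 - \<alpha>) * x t \<omega> $ i + \<alpha> * (\<Sum>j\<in>UNIV. W $ i $ j * a t \<omega> $ j)"
  using update[OF assms] by (simp add: matrix_vector_mult_def)

lemma opinion_range:
  assumes "t \<ge> 1" "\<omega> \<in> space M"
  shows "x t \<omega> $ i \<in> {0..1}"
  using assms(1)
proof (induction t arbitrary: i rule: dec_induct)
  case base
  then show ?case by (rule initial_range[OF assms(2)])
next
  case (step t)
  have W: "0 \<le> W $ i $ j" "(\<Sum>j\<in>UNIV. W $ i $ j) = 1" for j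
    using stochastic by (auto simp: row_stochastic_def)
  have a: "0 \<le> a t \<omega> $ j" "a t \<omega> $ j \<le> 1" for j
    using action_range[OF step.hyps(1) assms(2), of j] by auto
  have "0 \<le> (\<Sum>j\<in>UNIV. W $ i $ j * a t \<omega> $ j)"
    using W a by (intro sum_nonneg) auto
  moreover have "(\<Sum>j\<in>UNIV. W $ i $ j * a t \<omega> $ j) \<le> (\<Sum>j\<in>UNIV. W $ i $ j)"
    using W a by (intro sum_mono mult_left_le) auto
  ultimately have s: "(\<Sum>j\<in>UNIV. W $ i $ j * a t \<omega> $ j) \<in> {0..1}"
    using W by simp
  have "(1 - \<alpha>) * x t \<omega> $ i + \<alpha> * (\<Sum>j\<in>UNIV. W $ i $ j * a t \<omega> $ j) \<le> 1"
    using alpha s step.IH[of i] by (intro convex_bound_le) auto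
  then show ?case
    unfolding opinion_Suc[OF step.hyps(1) assms(2)] using alpha s step.IH[of i] by auto
qed

lemma history_measurable_action:
  assumes "s \<in> {1..<t}"
  shows "a s \<in> borel_measurable (history M x a t)"
proof -
  let ?N = "borel \<Otimes>\<^sub>M (\<Pi>\<^sub>M s\<in>{1..<t}. borel) :: ((real ^ 'n) \<times> (nat \<Rightarrow> real ^ 'n)) measure"
  have "(\<lambda>\<omega>. (x 1 \<omega>, \<lambda>s\<in>{1..<t}. a s \<omega>)) \<in> measurable (history M x a t) ?N"
    unfolding history_def
    by (rule measurable_vimage_algebra1) (auto simp: space_pair_measure space_PiM)
  moreover have "(\<lambda>z. snd z s) \<in> borel_measurable ?N"
    using assms by measurable
  ultimately have "(\<lambda>\<omega>. snd (x 1 \<omega>, \<lambda>s\<in>{1..<t}. a s \<omega>) s) \<in> borel_measurable (history M x a t)"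
    by (rule measurable_compose)
  then show ?thesis
    using assms by simp
qed

lemma history_measurable_initial: "x 1 \<in> borel_measurable (history M x a t)"
proof -
  let ?N = "borel \<Otimes>\<^sub>M (\<Pi>\<^sub>M s\<in>{1..<t}. borel) :: ((real ^ 'n) \<times> (nat \<Rightarrow> real ^ 'n)) measure"
  have "(\<lambda>\<omega>. (x 1 \<omega>, \<lambda>s\<in>{1..<t}. a s \<omega>)) \<in> measurable (history M x a t) ?N"
    unfolding history_def
    by (rule measurable_vimage_algebra1) (auto simp: space_pair_measure space_PiM)
  from measurable_compose[OF this measurable_fst] show ?thesis
    by simp
qed

text \<open>Unrolling the update expresses \<open>x s\<close> through \<open>x 1\<close> and the
  actions before time \<open>s\<close>, all of which are recorded in the history at
  \<open>t\<close>.\<close>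

lemma history_measurable_opinion:
  assumes "1 \<le> s" "s \<le> t"
  shows "x s \<in> borel_measurable (history M x a t)"
  using assms
proof (induction s rule: dec_induct)
  case base
  show ?case by (rule history_measurable_initial)
next
  case (step s)
  have [measurable]: "x s \<in> borel_measurable (history M x a t)"
    "a s \<in> borel_measurable (history M x a t)"
    using step by (auto intro: history_measurable_action)
  have "(\<lambda>v. W *v v) \<in> borel_measurable borel"
    by (intro borel_measurable_continuous_onI matrix_vector_mult_linear_continuous_on)
  note [measurable] = measurable_compose[OF _ this]
  have "(\<lambda>\<omega>. (1 - \<alpha>) *\<^sub>R x s \<omega> + \<alpha> *\<^sub>R (W *v a s \<omega>)) \<in> borel_measurable (history M x a t)"
    by measurable
  then show ?case
    \<comment> \<open>The update equation holds only on \<open>space M\<close>, which is also the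
      space of the history.\<close>
    by (rule measurable_cong[THEN iffD2, rotated])
      (use step in \<open>simp add: update history_def\<close>)
qed

lemma opinion_coord_history_measurable [measurable]:
  "t \<ge> 1 \<Longrightarrow> (\<lambda>\<omega>. x t \<omega> $ i) \<in> borel_measurable (history M x a t)"
  using measurable_compose[OF history_measurable_opinion[of t t] borel_measurable_nth] by simp

lemma opinion_coord_measurable [measurable]:
  assumes "t \<ge> 1" shows "(\<lambda>\<omega>. x t \<omega> $ i) \<in> borel_measurable M"
  using measurable_from_subalg[OF subalgebra_history opinion_coord_history_measurable[OF assms]] .

lemma action_coord_measurable [measurable]:
  "t \<ge> 1 \<Longrightarrow> (\<lambda>\<omega>. a t \<omega> $ i) \<in> borel_measurable M"
  using measurable_compose[OF action_measurable[of t] borel_measurable_nth] by simp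

section \<open>First and mixed second moments of the actions\<close>

lemma integrable_bounded_mult:
  fixes f g :: "'o \<Rightarrow> real"
  assumes [measurable]: "f \<in> borel_measurable M" "g \<in> borel_measurable M"
    and "\<And>\<omega>. \<omega> \<in> space M \<Longrightarrow> \<bar>f \<omega>\<bar> \<le> B" "\<And>\<omega>. \<omega> \<in> space M \<Longrightarrow> \<bar>g \<omega>\<bar> \<le> 1"
  shows "integrable M (\<lambda>\<omega>. f \<omega> * g \<omega>)"
proof (rule integrable_const_bound[where B = B])
  show "AE \<omega> in M. norm (f \<omega> * g \<omega>) \<le> B"
  proof (rule AE_I2)
    fix \<omega> assume "\<omega> \<in> space M"
    then have "\<bar>f \<omega>\<bar> * \<bar>g \<omega>\<bar> \<le> B * 1"
      using assms(3,4)[of \<omega>] by (intro mult_mono) auto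
    then show "norm (f \<omega> * g \<omega>) \<le> B" by (simp add: abs_mult)
  qed
qed measurable

text \<open>The defining property of conditional expectation, tested against a bounded
  history-measurable \<open>f\<close>; boundedness gives the required integrability.\<close>

lemma integral_prob_given:
  assumes "f \<in> borel_measurable (history M x a t)" "\<And>\<omega>. \<omega> \<in> space M \<Longrightarrow> \<bar>f \<omega>\<bar> \<le> B"
    and "{\<omega> \<in> space M. P \<omega>} \<in> events"
  shows "(\<integral>\<omega>. f \<omega> * prob_given M (history M x a t) P \<omega> \<partial>M)
    = (\<integral>\<omega>. f \<omega> * indicator {\<omega> \<in> space M. P \<omega>} \<omega> \<partial>M)"
proof -
  interpret F: finite_measure_subalgebra M "history M x a t"
    by unfold_locales (rule subalgebra_history)
  have [measurable]: "f \<in> borel_measurable M"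
    using measurable_from_subalg[OF subalgebra_history assms(1)] .
  have "integrable M (\<lambda>\<omega>. f \<omega> * indicator {\<omega> \<in> space M. P \<omega>} \<omega>)"
    using assms by (intro integrable_bounded_mult[of _ _ B]) (auto simp: indicator_def)
  then show ?thesis
    unfolding prob_given_def
    by (rule F.real_cond_exp_intg(2)) (use assms in auto)
qed

text \<open>The integrated form of the statement that \<open>x t\<close> is the conditional mean of
  \<open>a t\<close>. A 0/1 action coincides with the indicator of its being 1, so the Bernoulli
  assumption applies.\<close>

lemma integral_times_action:
  assumes t: "t \<ge> 1"
    and f: "f \<in> borel_measurable (history M x a t)" "\<And>\<omega>. \<omega> \<in> space M \<Longrightarrow> \<bar>f \<omega>\<bar> \<le> B"
  shows "(\<integral>\<omega>. f \<omega> * a t \<omega> $ i \<partial>M) = (\<integral>\<omega>. f \<omega> * x t \<omega> $ i \<partial>M)"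
proof -
  let ?H = "history M x a t"
  note [measurable] = action_coord_measurable[OF t] opinion_coord_measurable[OF t]
  have [measurable]: "f \<in> borel_measurable M"
    using measurable_from_subalg[OF subalgebra_history f(1)] .
  have "prob_given M ?H P \<in> borel_measurable M" for P
    unfolding prob_given_def by (rule borel_measurable_cond_exp2)
  note [measurable] = this
  have "(\<integral>\<omega>. f \<omega> * a t \<omega> $ i \<partial>M) =
      (\<integral>\<omega>. f \<omega> * indicator {\<omega> \<in> space M. a t \<omega> $ i = 1} \<omega> \<partial>M)"
    using action_range[OF t, of _ i] by (intro Bochner_Integration.integral_cong) (auto simp: indicator_def)
  also have "\<dots> = (\<integral>\<omega>. f \<omega> * prob_given M ?H (\<lambda>\<omega>. a t \<omega> $ i = 1) \<omega> \<partial>M)"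
    by (rule integral_prob_given[OF f, symmetric]) auto
  also have "\<dots> = (\<integral>\<omega>. f \<omega> * x t \<omega> $ i \<partial>M)"
    using action_bernoulli[OF t, of i] by (intro integral_cong_AE) auto
  finally show ?thesis .
qed

text \<open>Conditional independence enters here: the product of two actions is the indicator that
  both are 1, and the conditional probability of this event factorises.\<close>

lemma integral_action_times_action:
  assumes t: "t \<ge> 1" and ij: "i \<noteq> j"
  shows "(\<integral>\<omega>. a t \<omega> $ i * a t \<omega> $ j \<partial>M) = (\<integral>\<omega>. x t \<omega> $ i * x t \<omega> $ j \<partial>M)"
proof -
  let ?H = "history M x a t"
  note [measurable] = action_coord_measurable[OF t] opinion_coord_measurable[OF t]
  have "prob_given M ?H P \<in> borel_measurable M" for P
    unfolding prob_given_def by (rule borel_measurable_cond_exp2)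
  note [measurable] = this
  let ?P = "\<lambda>\<omega>. \<forall>k\<in>{i, j}. a t \<omega> $ k \<in> {1}"
  have "AE \<omega> in M. prob_given M ?H ?P \<omega> =
      (\<Prod>k\<in>{i, j}. prob_given M ?H (\<lambda>\<omega>. a t \<omega> $ k \<in> {1}) \<omega>)"
    using action_indep[OF t] unfolding cond_indep_vars_def
    by (elim conjE allE[of _ "{i, j}"] impE ballE[of _ _ "\<lambda>_. {1}"]) auto
  \<comment> \<open>Distinctness of \<open>i\<close> and \<open>j\<close> makes the product over
    \<open>{i, j}\<close> one of two factors.\<close>
  then have AE: "AE \<omega> in M. prob_given M ?H ?P \<omega> = x t \<omega> $ i * x t \<omega> $ j"
    using action_bernoulli[OF t, of i] action_bernoulli[OF t, of j]
    by eventually_elim (use ij in simp)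
  have "(\<integral>\<omega>. a t \<omega> $ i * a t \<omega> $ j \<partial>M) = (\<integral>\<omega>. 1 * indicator {\<omega> \<in> space M. ?P \<omega>} \<omega> \<partial>M)"
    using action_range[OF t, of _ i] action_range[OF t, of _ j]
    by (intro Bochner_Integration.integral_cong) (auto simp: indicator_def)
  also have "\<dots> = (\<integral>\<omega>. 1 * prob_given M ?H ?P \<omega> \<partial>M)"
    by (rule integral_prob_given[of _ _ 1, symmetric]) auto
  also have "\<dots> = (\<integral>\<omega>. x t \<omega> $ i * x t \<omega> $ j \<partial>M)"
    using AE by (intro integral_cong_AE) auto
  finally show ?thesis .
qed

section \<open>Noise of the actions and the martingale of weighted means\<close>

text \<open>A martingale difference: the action minus its conditional mean given the
  history.\<close>

definition noise :: "nat \<Rightarrow> 'o \<Rightarrow> 'n \<Rightarrow> real" where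
  "noise t \<omega> i = a t \<omega> $ i - x t \<omega> $ i"

lemma noise_measurable [measurable]:
  "t \<ge> 1 \<Longrightarrow> (\<lambda>\<omega>. noise t \<omega> i) \<in> borel_measurable M"
  unfolding noise_def by (intro borel_measurable_diff action_coord_measurable opinion_coord_measurable)

lemma opinion_abs: "t \<ge> 1 \<Longrightarrow> \<omega> \<in> space M \<Longrightarrow> \<bar>x t \<omega> $ i\<bar> \<le> 1"
  using opinion_range[of t \<omega> i] by simp

lemma action_abs: "t \<ge> 1 \<Longrightarrow> \<omega> \<in> space M \<Longrightarrow> \<bar>a t \<omega> $ i\<bar> \<le> 1"
  using action_range[of t \<omega> i] by auto

lemma noise_abs: "t \<ge> 1 \<Longrightarrow> \<omega> \<in> space M \<Longrightarrow> \<bar>noise t \<omega> i\<bar> \<le> 1"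
  using opinion_range[of t \<omega> i] action_range[of t \<omega> i] by (auto simp: noise_def)

text \<open>Zero conditional mean, in the form of orthogonality to bounded functions of the
  history.\<close>

lemma integral_times_noise:
  assumes t: "t \<ge> 1"
    and f: "f \<in> borel_measurable (history M x a t)" "\<And>\<omega>. \<omega> \<in> space M \<Longrightarrow> \<bar>f \<omega>\<bar> \<le> B"
  shows "(\<integral>\<omega>. f \<omega> * noise t \<omega> i \<partial>M) = 0"
proof -
  have [measurable]: "f \<in> borel_measurable M"
    using measurable_from_subalg[OF subalgebra_history f(1)] .
  have "integrable M (\<lambda>\<omega>. f \<omega> * a t \<omega> $ i)" "integrable M (\<lambda>\<omega>. f \<omega> * x t \<omega> $ i)"
    by (intro integrable_bounded_mult[OF _ _ f(2)] action_coord_measurable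
        opinion_coord_measurable opinion_abs action_abs; use t in simp)+
  then show ?thesis
    using integral_times_action[OF t f, of i] by (simp add: noise_def right_diff_distrib)
qed

lemma integral_noise_times_noise:
  assumes t: "t \<ge> 1" and ij: "i \<noteq> j"
  shows "(\<integral>\<omega>. noise t \<omega> i * noise t \<omega> j \<partial>M) = 0"
proof -
  note meas = action_coord_measurable[OF t] opinion_coord_measurable[OF t] noise_measurable[OF t]
  note bnd = opinion_abs[OF t] action_abs[OF t] noise_abs[OF t]
  have i1: "integrable M (\<lambda>\<omega>. a t \<omega> $ i * a t \<omega> $ j)"
    and i2: "integrable M (\<lambda>\<omega>. x t \<omega> $ j * a t \<omega> $ i)"
    and i3: "integrable M (\<lambda>\<omega>. x t \<omega> $ i * noise t \<omega> j)"
    by (auto intro!: integrable_bounded_mult meas bnd)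
  \<comment> \<open>Only one factor is expanded fully: the last term is noise against a function of
    the history and integrates to 0, and the first two have the same integral as
    \<open>x t \<omega> $ i * x t \<omega> $ j\<close>.\<close>
  have "(\<integral>\<omega>. noise t \<omega> i * noise t \<omega> j \<partial>M) =
      (\<integral>\<omega>. a t \<omega> $ i * a t \<omega> $ j - x t \<omega> $ j * a t \<omega> $ i - x t \<omega> $ i * noise t \<omega> j \<partial>M)"
    by (intro Bochner_Integration.integral_cong) (auto simp: noise_def algebra_simps)
  also have "\<dots> = (\<integral>\<omega>. a t \<omega> $ i * a t \<omega> $ j \<partial>M) - (\<integral>\<omega>. x t \<omega> $ j * a t \<omega> $ i \<partial>M)
      - (\<integral>\<omega>. x t \<omega> $ i * noise t \<omega> j \<partial>M)"
    by (simp add: i1 i2 i3)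
  also have "(\<integral>\<omega>. x t \<omega> $ i * noise t \<omega> j \<partial>M) = 0"
    by (rule integral_times_noise[OF t opinion_coord_history_measurable[OF t] opinion_abs[OF t]])
  also have "(\<integral>\<omega>. x t \<omega> $ j * a t \<omega> $ i \<partial>M) = (\<integral>\<omega>. x t \<omega> $ j * x t \<omega> $ i \<partial>M)"
    by (rule integral_times_action[OF t opinion_coord_history_measurable[OF t] opinion_abs[OF t]])
  finally show ?thesis
    by (simp add: integral_action_times_action[OF t ij] mult.commute)
qed

text \<open>For stationary \<open>p\<close> the weighted mean opinion is a martingale with increments
  \<open>\<alpha> * (\<Sum>i. p $ i * noise t \<omega> i)\<close>.\<close>

lemma second_moment_step:
  assumes t: "t \<ge> 1" and p: "p v* W = p"
  shows "(\<integral>\<omega>. (\<Sum>i\<in>UNIV. p $ i * x (Suc t) \<omega> $ i)\<^sup>2 \<partial>M) - (\<integral>\<omega>. (\<Sum>i\<in>UNIV. p $ i * x t \<omega> $ i)\<^sup>2 \<partial>M)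
    = \<alpha>\<^sup>2 * (\<Sum>i\<in>UNIV. (p $ i)\<^sup>2 * (\<integral>\<omega>. (noise t \<omega> i)\<^sup>2 \<partial>M))"
proof -
  define m where "m = (\<lambda>\<omega>. \<Sum>i\<in>UNIV. p $ i * x t \<omega> $ i)"
  define e where "e = (\<lambda>\<omega>. \<Sum>i\<in>UNIV. p $ i * noise t \<omega> i)"
  \<comment> \<open>A bound for \<open>\<bar>m \<omega>\<bar>\<close>, as opinions have absolute
    value at most 1.\<close>
  define B where "B = (\<Sum>i\<in>UNIV. \<bar>p $ i\<bar>)"
  note meas = opinion_coord_measurable[OF t] noise_measurable[OF t]
  note [measurable] = meas
  have m_hist: "m \<in> borel_measurable (history M x a t)"
    unfolding m_def
    by (intro borel_measurable_sum borel_measurable_times borel_measurable_const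
        opinion_coord_history_measurable t)
  have [measurable]: "m \<in> borel_measurable M"
    unfolding m_def by measurable
  have m_abs: "\<bar>m \<omega>\<bar> \<le> B" if "\<omega> \<in> space M" for \<omega>
    unfolding m_def B_def
    by (rule order_trans[OF sum_abs])
      (use opinion_abs[OF t that] in \<open>auto intro!: sum_mono mult_left_le simp: abs_mult\<close>)
  have m2: "integrable M (\<lambda>\<omega>. (m \<omega>)\<^sup>2)"
  proof (rule integrable_const_bound[where B = "B\<^sup>2"])
    show "AE \<omega> in M. norm ((m \<omega>)\<^sup>2) \<le> B\<^sup>2"
      using m_abs by (intro AE_I2) (simp add: abs_le_square_iff[symmetric] order_trans[OF m_abs abs_ge_self])
  qed measurable
  have int_mn: "integrable M (\<lambda>\<omega>. m \<omega> * noise t \<omega> i)" for i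
    by (intro integrable_bounded_mult[OF _ _ m_abs] noise_abs t) auto
  have int_nn: "integrable M (\<lambda>\<omega>. noise t \<omega> i * noise t \<omega> j)" for i j
    by (intro integrable_bounded_mult[OF _ _ noise_abs noise_abs] t) auto
  have me: "m \<omega> * e \<omega> = (\<Sum>i\<in>UNIV. p $ i * (m \<omega> * noise t \<omega> i))" for \<omega>
    by (simp add: e_def sum_distrib_left mult_ac)
  have ee: "(e \<omega>)\<^sup>2 = (\<Sum>i\<in>UNIV. \<Sum>j\<in>UNIV. p $ i * p $ j * (noise t \<omega> i * noise t \<omega> j))" for \<omega>
    by (simp add: e_def power2_eq_square sum_product mult_ac)
  \<comment> \<open>Exchanging the sums moves \<open>W\<close> from the actions to \<open>p\<close>,
    where stationarity absorbs it.\<close>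
  have next_mean: "(\<Sum>i\<in>UNIV. p $ i * x (Suc t) \<omega> $ i) = m \<omega> + \<alpha> * e \<omega>" if "\<omega> \<in> space M" for \<omega>
  proof -
    have "(\<Sum>i\<in>UNIV. p $ i * (\<Sum>j\<in>UNIV. W $ i $ j * a t \<omega> $ j)) =
        (\<Sum>j\<in>UNIV. (\<Sum>i\<in>UNIV. W $ i $ j * p $ i) * a t \<omega> $ j)"
      by (simp add: sum_distrib_left sum_distrib_right mult_ac) (rule sum.swap)
    also have "\<dots> = (\<Sum>j\<in>UNIV. p $ j * a t \<omega> $ j)"
      by (subst (2) p[symmetric]) (simp add: vector_matrix_mult_def mult.commute)
    finally have "(\<Sum>i\<in>UNIV. p $ i * x (Suc t) \<omega> $ i) =
        (1 - \<alpha>) * m \<omega> + \<alpha> * (\<Sum>j\<in>UNIV. p $ j * a t \<omega> $ j)"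
      by (simp add: opinion_Suc[OF t that] m_def distrib_left sum.distrib mult.left_commute[of _ \<alpha>]
          mult.left_commute[of _ "1 - \<alpha>"] flip: sum_distrib_left)
    then show ?thesis
      by (simp add: m_def e_def noise_def right_diff_distrib sum_subtractf algebra_simps)
  qed
  have "(\<integral>\<omega>. (\<Sum>i\<in>UNIV. p $ i * x (Suc t) \<omega> $ i)\<^sup>2 \<partial>M) =
      (\<integral>\<omega>. (m \<omega>)\<^sup>2 + 2 * \<alpha> * (m \<omega> * e \<omega>) + \<alpha>\<^sup>2 * (e \<omega>)\<^sup>2 \<partial>M)"
    by (intro Bochner_Integration.integral_cong)
      (simp_all add: next_mean power2_eq_square algebra_simps)
  also have "\<dots> = (\<integral>\<omega>. (m \<omega>)\<^sup>2 \<partial>M) + 2 * \<alpha> * (\<integral>\<omega>. m \<omega> * e \<omega> \<partial>M) + \<alpha>\<^sup>2 * (\<integral>\<omega>. (e \<omega>)\<^sup>2 \<partial>M)"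
    unfolding me ee using m2 int_mn int_nn by simp
  \<comment> \<open>The mean \<open>m\<close> is a function of the history, hence orthogonal to the
    noise.\<close>
  also have "(\<integral>\<omega>. m \<omega> * e \<omega> \<partial>M) = 0"
    unfolding me using int_mn by (simp add: integral_times_noise[OF t m_hist m_abs])
  also have "(\<integral>\<omega>. (e \<omega>)\<^sup>2 \<partial>M) =
      (\<Sum>i\<in>UNIV. \<Sum>j\<in>UNIV. p $ i * p $ j * (\<integral>\<omega>. noise t \<omega> i * noise t \<omega> j \<partial>M))"
    unfolding ee using int_nn by simp
  \<comment> \<open>Noises of distinct agents are uncorrelated, so only the diagonal
    survives.\<close>
  also have "\<dots> = (\<Sum>i\<in>UNIV. \<Sum>j\<in>UNIV. if j = i then (p $ i)\<^sup>2 * (\<integral>\<omega>. (noise t \<omega> i)\<^sup>2 \<partial>M) else 0)"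
    by (intro sum.cong) (auto simp: integral_noise_times_noise[OF t] power2_eq_square)
  finally show ?thesis
    by (simp add: m_def)
qed

text \<open>The second moments of the weighted mean increase and stay below 1, so their increments
  are summable. Each increment dominates the contribution of agent \<open>i\<close>, whose weight is
  positive. Index \<open>n\<close> stands for time \<open>n + 1\<close>.\<close>

lemma summable_noise_variance: "summable (\<lambda>n. \<integral>\<omega>. (noise (Suc n) \<omega> i)\<^sup>2 \<partial>M)"
proof -
  obtain p :: "real ^ 'n" where p: "\<And>i. 0 \<le> p $ i" "(\<Sum>i\<in>UNIV. p $ i) = 1" "p v* W = p"
    using stationary_distribution[OF stochastic] by metis
  have pos: "0 < p $ i"
    by (rule irreducible_stationary_positive[OF stochastic irreducible p])
  define m where "m = (\<lambda>n. \<integral>\<omega>. (\<Sum>i\<in>UNIV. p $ i * x (Suc n) \<omega> $ i)\<^sup>2 \<partial>M)"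
  define v where "v = (\<lambda>n i. \<integral>\<omega>. (noise (Suc n) \<omega> i)\<^sup>2 \<partial>M)"
  have v0: "0 \<le> v n i" for n i
    by (simp add: v_def)
  have step: "m (Suc n) - m n = \<alpha>\<^sup>2 * (\<Sum>i\<in>UNIV. (p $ i)\<^sup>2 * v n i)" for n
    unfolding m_def v_def by (rule second_moment_step[OF _ p(3)]) simp
  have "m n \<le> m (Suc n)" for n
  proof -
    have "0 \<le> \<alpha>\<^sup>2 * (\<Sum>i\<in>UNIV. (p $ i)\<^sup>2 * v n i)"
      by (intro mult_nonneg_nonneg sum_nonneg v0) auto
    then show ?thesis
      using step[of n] by simp
  qed
  then have "incseq m"
    by (rule incseq_SucI)
  moreover have "m n \<le> 1" for n
  proof -
    \<comment> \<open>A convex combination of opinions lies in [0, 1].\<close>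
    have sq: "(\<Sum>i\<in>UNIV. p $ i * x (Suc n) \<omega> $ i)\<^sup>2 \<le> 1" if "\<omega> \<in> space M" for \<omega>
    proof -
      have r: "0 \<le> x (Suc n) \<omega> $ i" "x (Suc n) \<omega> $ i \<le> 1" for i
        using opinion_range[of "Suc n" \<omega> i] that by auto
      have "(\<Sum>i\<in>UNIV. p $ i * x (Suc n) \<omega> $ i) \<le> (\<Sum>i\<in>UNIV. p $ i)"
        using r p(1) by (intro sum_mono mult_left_le) auto
      moreover have "0 \<le> (\<Sum>i\<in>UNIV. p $ i * x (Suc n) \<omega> $ i)"
        using r p(1) by (intro sum_nonneg) auto
      ultimately show ?thesis
        using p(2) by (intro power_le_one) auto
    qed
    have "m n \<le> (\<integral>\<omega>. 1 \<partial>M)"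
      unfolding m_def
    proof (rule integral_mono)
      show "integrable M (\<lambda>\<omega>. (\<Sum>i\<in>UNIV. p $ i * x (Suc n) \<omega> $ i)\<^sup>2)"
        using sq by (intro integrable_const_bound[where B = 1] AE_I2) auto
    qed (use sq in auto)
    then show ?thesis by (simp add: prob_space)
  qed
  ultimately obtain l where "m \<longlonglongrightarrow> l"
    using incseq_convergent[of m 1] by metis
  then have "summable (\<lambda>n. m (Suc n) - m n)"
    by (rule telescope_summable)
  then have "summable (\<lambda>n. (m (Suc n) - m n) / (\<alpha>\<^sup>2 * (p $ i)\<^sup>2))"
    by (rule summable_divide)
  moreover have "norm (v n i) \<le> (m (Suc n) - m n) / (\<alpha>\<^sup>2 * (p $ i)\<^sup>2)" for n
  proof -
    have "(p $ i)\<^sup>2 * v n i \<le> (\<Sum>i\<in>UNIV. (p $ i)\<^sup>2 * v n i)"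
      using v0 by (intro member_le_sum) auto
    then have "\<alpha>\<^sup>2 * ((p $ i)\<^sup>2 * v n i) \<le> m (Suc n) - m n"
      unfolding step by (rule mult_left_mono) simp
    then show ?thesis
      using alpha pos v0[of n i] by (simp add: field_simps)
  qed
  ultimately show ?thesis
    unfolding v_def by (rule summable_comparison_test')
qed

section \<open>Almost sure convergence\<close>

text \<open>By monotone convergence the sum of the squared noises has finite expectation, so it is
  almost surely finite and its terms tend to 0.\<close>

lemma AE_noise_tendsto_zero: "AE \<omega> in M. (\<lambda>n. noise (Suc n) \<omega> i) \<longlonglongrightarrow> 0"
proof -
  have meas [measurable]: "(\<lambda>\<omega>. noise (Suc n) \<omega> i) \<in> borel_measurable M" for n
    by (rule noise_measurable) simp
  have int: "integrable M (\<lambda>\<omega>. (noise (Suc n) \<omega> i)\<^sup>2)" for n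
    unfolding power2_eq_square
    by (intro integrable_bounded_mult[OF _ _ noise_abs noise_abs]) auto
  have "(\<integral>\<^sup>+\<omega>. (\<Sum>n. ennreal ((noise (Suc n) \<omega> i)\<^sup>2)) \<partial>M) =
      (\<Sum>n. \<integral>\<^sup>+\<omega>. ennreal ((noise (Suc n) \<omega> i)\<^sup>2) \<partial>M)"
    by (rule nn_integral_suminf) measurable
  also have "\<dots> = (\<Sum>n. ennreal (\<integral>\<omega>. (noise (Suc n) \<omega> i)\<^sup>2 \<partial>M))"
    using int by (simp add: nn_integral_eq_integral)
  also have "\<dots> = ennreal (\<Sum>n. \<integral>\<omega>. (noise (Suc n) \<omega> i)\<^sup>2 \<partial>M)"
    by (intro suminf_ennreal_eq summable_sums summable_noise_variance) simp
  finally have "(\<integral>\<^sup>+\<omega>. (\<Sum>n. ennreal ((noise (Suc n) \<omega> i)\<^sup>2)) \<partial>M) \<noteq> \<infinity>"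
    by simp
  then have "AE \<omega> in M. (\<Sum>n. ennreal ((noise (Suc n) \<omega> i)\<^sup>2)) \<noteq> \<infinity>"
    by (intro nn_integral_PInf_AE) measurable
  then show ?thesis
  proof eventually_elim
    case (elim \<omega>)
    then have "summable (\<lambda>n. (noise (Suc n) \<omega> i)\<^sup>2)"
      by (intro summable_suminf_not_top) auto
    then have "(\<lambda>n. (noise (Suc n) \<omega> i)\<^sup>2) \<longlonglongrightarrow> 0"
      by (rule summable_LIMSEQ_zero)
    then show ?case
      by (simp add: power_tendsto_0_iff)
  qed
qed

text \<open>There are finitely many agents, so one null set serves them all; outside it the
  deterministic result applies to each trajectory.\<close>

lemma AE_consensus:
  "AE \<omega> in M. (\<forall>i. (\<lambda>n. x (Suc n) \<omega> $ i) \<longlonglongrightarrow> 0) \<or> (\<forall>i. (\<lambda>n. x (Suc n) \<omega> $ i) \<longlonglongrightarrow> 1)"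
proof -
  have "AE \<omega> in M. \<forall>i\<in>UNIV. (\<lambda>n. noise (Suc n) \<omega> i) \<longlonglongrightarrow> 0"
    by (intro AE_finite_allI AE_noise_tendsto_zero) simp
  with AE_space show ?thesis
  proof eventually_elim
    case (elim \<omega>)
    have "x (Suc (Suc n)) \<omega> = (1 - \<alpha>) *\<^sub>R x (Suc n) \<omega> + \<alpha> *\<^sub>R (W *v a (Suc n) \<omega>)" for n
      using update[of "Suc n" \<omega>] elim(1) by simp
    moreover have "x (Suc n) \<omega> $ i \<in> {0..1}" "a (Suc n) \<omega> $ i \<in> {0, 1}" for n i
      using opinion_range[of "Suc n" \<omega> i] action_range[of "Suc n" \<omega> i] elim(1) by auto
    ultimately show ?case
      using elim(2) unfolding noise_def
      by (intro deterministic_consensus[OF alpha stochastic irreducible,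
            of "\<lambda>n. x (Suc n) \<omega>" "\<lambda>n. a (Suc n) \<omega>"]) auto
  qed
qed

lemma consensus_measurable:
  assumes "t \<ge> 1"
  shows "consensus0 M x \<delta> t \<in> events" "consensus1 M x \<delta> t \<in> events"
  using opinion_coord_measurable[OF assms] unfolding consensus0_def consensus1_def by measurable

end

section \<open>From almost sure consensus to a fixed time\<close>

theorem theorem1:
  fixes M :: "'o measure"
    and \<alpha> :: real
    and W :: "real ^ 'n ^ 'n"
    and x a :: "nat \<Rightarrow> 'o \<Rightarrow> real ^ 'n"
  assumes "random_actions M \<alpha> W x a"
  shows "\<forall>\<epsilon>>0. \<forall>\<delta>>0. \<exists>t\<ge>1. \<forall>S\<ge>1.
    measure M (\<Inter>s\<in>{0..S}. consensus0 M x \<delta> (t + s)) +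
    measure M (\<Inter>s\<in>{0..S}. consensus1 M x \<delta> (t + s)) > 1 - \<epsilon>"
proof (intro allI impI)
  fix \<epsilon> \<delta> :: real
  assume \<epsilon>: "0 < \<epsilon>" and \<delta>: "0 < \<delta>"
  interpret random_actions M \<alpha> W x a by fact
  \<comment> \<open>Infinite horizons make \<open>A t\<close> and \<open>B t\<close> increase with
    \<open>t\<close> and make the final bound uniform in \<open>S\<close>. The shift by
    \<open>Suc\<close> keeps all times at least 1.\<close>
  define A where "A = (\<lambda>t. \<Inter>s. consensus0 M x \<delta> (Suc t + s))"
  define B where "B = (\<lambda>t. \<Inter>s. consensus1 M x \<delta> (Suc t + s))"
  have A_meas [measurable]: "A t \<in> events" and B_meas [measurable]: "B t \<in> events" for t
    unfolding A_def B_def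
    by (intro sets.countable_INT consensus_measurable; auto intro: consensus_measurable)+
  have mono: "incseq (\<lambda>t. A t \<union> B t)"
  proof (rule incseq_SucI)
    fix t
    have "A t \<subseteq> A (Suc t)" "B t \<subseteq> B (Suc t)"
      unfolding A_def B_def by (auto simp flip: add_Suc_right)
    then show "A t \<union> B t \<subseteq> A (Suc t) \<union> B (Suc t)" by blast
  qed
  have "AE \<omega> in M. \<omega> \<in> (\<Union>t. A t \<union> B t)"
    using AE_space AE_consensus
  proof eventually_elim
    case (elim \<omega>)
    have r: "0 \<le> x (Suc n) \<omega> $ i" "x (Suc n) \<omega> $ i \<le> 1" for n i
      using opinion_range[of "Suc n" \<omega> i] elim(1) by auto
    from elim(2) show ?case
    proof
      assume "\<forall>i. (\<lambda>n. x (Suc n) \<omega> $ i) \<longlonglongrightarrow> 0"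
      then have "\<forall>i. \<forall>\<^sub>F n in sequentially. x (Suc n) \<omega> $ i < \<delta>"
        using \<delta> order_tendstoD(2) by blast
      \<comment> \<open>Finiteness of the set of agents yields a common threshold.\<close>
      then have "\<forall>\<^sub>F n in sequentially. \<forall>i. x (Suc n) \<omega> $ i < \<delta>"
        by (simp add: eventually_all_finite)
      then obtain K where "\<And>n i. n \<ge> K \<Longrightarrow> x (Suc n) \<omega> $ i < \<delta>"
        by (auto simp: eventually_sequentially)
      then have "\<omega> \<in> A K"
        using r elim(1) by (auto simp: A_def consensus0_def)
      then show ?thesis by blast
    next
      assume "\<forall>i. (\<lambda>n. x (Suc n) \<omega> $ i) \<longlonglongrightarrow> 1"
      moreover have "1 - \<delta> < 1" using \<delta> by simp
      ultimately have "\<forall>i. \<forall>\<^sub>F n in sequentially. 1 - \<delta> < x (Suc n) \<omega> $ i"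
        using order_tendstoD(1) by blast
      then have "\<forall>\<^sub>F n in sequentially. \<forall>i. 1 - \<delta> < x (Suc n) \<omega> $ i"
        by (simp add: eventually_all_finite)
      then obtain K where "\<And>n i. n \<ge> K \<Longrightarrow> 1 - \<delta> < x (Suc n) \<omega> $ i"
        by (auto simp: eventually_sequentially)
      then have "\<omega> \<in> B K"
        using r elim(1) by (auto simp: B_def consensus1_def)
      then show ?thesis by blast
    qed
  qed
  then have "prob (\<Union>t. A t \<union> B t) = 1"
    by (intro prob_eq_1[THEN iffD2]) auto
  \<comment> \<open>Continuity from below along the increasing union.\<close>
  then have "(\<lambda>t. prob (A t \<union> B t)) \<longlonglongrightarrow> 1"
    using finite_Lim_measure_incseq[OF _ mono] by (auto simp: image_subset_iff)
  then have "\<forall>\<^sub>F t in sequentially. 1 - \<epsilon> < prob (A t \<union> B t)"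
    using \<epsilon> by (intro order_tendstoD(1)) auto
  then obtain t where t: "1 - \<epsilon> < prob (A t \<union> B t)"
    by (auto simp: eventually_sequentially)
  show "\<exists>t\<ge>1. \<forall>S\<ge>1. prob (\<Inter>s\<in>{0..S}. consensus0 M x \<delta> (t + s)) +
      prob (\<Inter>s\<in>{0..S}. consensus1 M x \<delta> (t + s)) > 1 - \<epsilon>"
  proof (intro exI[of _ "Suc t"] conjI allI impI)
    fix S :: nat
    \<comment> \<open>Subadditivity has the right direction, even where a large
      \<open>\<delta>\<close> makes the two events overlap.\<close>
    have "prob (A t \<union> B t) \<le> prob (A t) + prob (B t)"
      by (rule measure_Un_le) auto
    also have "prob (A t) \<le> prob (\<Inter>s\<in>{0..S}. consensus0 M x \<delta> (Suc t + s))"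
      unfolding A_def
      by (intro finite_measure_mono sets.finite_INT consensus_measurable INT_anti_mono) auto
    also have "prob (B t) \<le> prob (\<Inter>s\<in>{0..S}. consensus1 M x \<delta> (Suc t + s))"
      unfolding B_def
      by (intro finite_measure_mono sets.finite_INT consensus_measurable INT_anti_mono) auto
    finally show "1 - \<epsilon> < prob (\<Inter>s\<in>{0..S}. consensus0 M x \<delta> (Suc t + s)) +
        prob (\<Inter>s\<in>{0..S}. consensus1 M x \<delta> (Suc t + s))"
      using t by simp
  qed simp
qed

end
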